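(* Let $t \neq 0, 1$ be a square-free integer such that the curve $t u^2 = 1 + 4k^3$ has a nonzero rational solution $(u,k)$. Then the system $A + B = C$, $ABC = D^3$ has infinitely many solutions $(A,B,C,D)$ with $A,B,C,D \in \mathbb{Q}(\sqrt{t})$. *)

theory Defs
  imports Complex_Main "HOL-Computational_Algebra.Squarefree"
begin

text \<open>
  The field $\mathbf{Q}(\sqrt t)$ inside the complex numbers; for negative \<open>t\<close> the
  function \<open>csqrt\<close> picks the root with positive imaginary part.  The other root
  gives the same set.
\<close>

definition quadratic_field :: "int \<Rightarrow> complex set" where
  "quadratic_field t = {of_rat a + of_rat b * csqrt (of_int t) | a b :: rat. True}"

text \<open>
  Solutions are quadruples, not classes of quadruples up to a common factor.
  Those with a vanishing coordinate, such as \<open>(0, B, B, 0)\<close>, are excluded: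
  they exist in infinite number over every field of characteristic 0.
\<close>

definition nonzero_solutions :: "complex set \<Rightarrow> (complex \<times> complex \<times> complex \<times> complex) set" where
  "nonzero_solutions K =
     {(A, B, C, D). A \<in> K \<and> B \<in> K \<and> C \<in> K \<and> D \<in> K \<and>
        A \<noteq> 0 \<and> B \<noteq> 0 \<and> C \<noteq> 0 \<and> D \<noteq> 0 \<and>
        A + B = C \<and> A * B * C = D ^ 3}"

end

theory Submission imports Defs
begin

text \<open>
  Put \<open>s = u \<surd>t\<close>, so \<open>s\<^sup>2 = 1 + 4 k\<^sup>3\<close>.  Then \<open>A = (1 + s)/2\<close> and \<open>B = (1 - s)/2\<close> have sum
  \<open>C = 1\<close> and product \<open>(1 - s\<^sup>2)/4 = (-k)\<^sup>3\<close>.  This solution is nonzero as soon as \<open>k \<noteq> 0\<close>, and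
  \<open>k = 0\<close> would make \<open>t\<close> a rational square.  The system is homogeneous, so the rational multiples
  of one nonzero solution form an infinite family.
\<close>

text \<open>Write \<open>u = p / q\<close> in lowest terms, so \<open>t * p ^ 2 = q ^ 2\<close>.
  Coprimality leaves only a unit for \<open>p\<close>, hence \<open>t\<close> is the square of
  \<open>q\<close>, and a squarefree square is 1. This is what rules out \<open>k = 0\<close> on the
  curve.\<close>

lemma squarefree_int_rat_square_eq_1:
  fixes t :: int and u :: rat
  assumes "squarefree t" and eq: "of_int t * u ^ 2 = 1"
  shows "t = 1"
proof -
  obtain p q where u: "u = of_int p / of_int q" and q: "q > 0" and pq: "coprime p q"
    by (cases u) (auto simp: Fract_of_int_quotient)
  have "of_int (t * p ^ 2) = (of_int (q ^ 2) :: rat)"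
    using eq q by (simp add: u power_divide field_simps)
  then have *: "t * p ^ 2 = q ^ 2"
    by (simp only: of_int_eq_iff)
  \<comment> \<open>\<open>p ^ 2\<close> divides \<open>q ^ 2\<close>, and divisibility of squares
    descends to the bases.\<close>
  then have "p dvd q"
    by (metis dvd_triv_right pow_divides_pow_iff zero_less_numeral)
  then have "is_unit p"
    using pq by (meson coprime_common_divisor dvd_refl)
  then have "p ^ 2 = 1"
    using power2_abs[of p] by simp
  then have t: "t = q ^ 2"
    using * by simp
  then have "is_unit q"
    using \<open>squarefree t\<close> by (simp add: squarefree_def)
  then show ?thesis
    using q t by simp
qed

lemma of_rat_mult_in_quadratic_field:
  assumes "x \<in> quadratic_field t"
  shows "of_rat r * x \<in> quadratic_field t"
proof -
  obtain a b where "x = of_rat a + of_rat b * csqrt (of_int t)"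
    using assms by (auto simp: quadratic_field_def)
  then have "of_rat r * x = of_rat (r * a) + of_rat (r * b) * csqrt (of_int t)"
    by (simp add: of_rat_mult algebra_simps)
  then show ?thesis
    unfolding quadratic_field_def by blast
qed

text \<open>Scaling by a rational \<open>r\<close> multiplies both sides of the cubic equation by
  \<open>r ^ 3\<close>. Since \<open>A\<close> is nonzero, different scalars already differ in the
  first coordinate.\<close>

lemma infinite_nonzero_solutions:
  assumes "(A, B, C, D) \<in> nonzero_solutions (quadratic_field t)"
  shows "infinite (nonzero_solutions (quadratic_field t))"
proof -
  \<comment> \<open>The scalars start at 1, since the factor 0 would give the excluded zero
    quadruple.\<close>
  define f :: "nat \<Rightarrow> complex \<times> complex \<times> complex \<times> complex" where
    "f n = (let r = of_rat (of_nat (Suc n)) in (r * A, r * B, r * C, r * D))" for n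
  have "A \<noteq> 0"
    using assms by (simp add: nonzero_solutions_def)
  then have "inj f"
    by (auto simp: inj_def f_def Let_def simp del: of_nat_Suc)
  have "f n \<in> nonzero_solutions (quadratic_field t)" for n
  proof -
    define r :: complex where "r = of_rat (of_nat (Suc n))"
    have "r \<noteq> 0"
      by (simp add: r_def del: of_nat_Suc)
    moreover have "r * x \<in> quadratic_field t" if "x \<in> quadratic_field t" for x
      using of_rat_mult_in_quadratic_field[OF that] by (simp only: r_def)
    moreover have "(r * A) * (r * B) * (r * C) = (r * D) ^ 3"
    proof -
      have "(r * A) * (r * B) * (r * C) = r ^ 3 * (A * B * C)"
        by (simp add: power3_eq_cube)
      also have "A * B * C = D ^ 3"
        using assms by (simp add: nonzero_solutions_def)
      finally show ?thesis
        by (simp only: power_mult_distrib)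
    qed
    ultimately have "(r * A, r * B, r * C, r * D) \<in> nonzero_solutions (quadratic_field t)"
      using assms by (auto simp: nonzero_solutions_def simp flip: distrib_left)
    then show ?thesis
      by (simp only: f_def r_def Let_def)
  qed
  then show ?thesis
    using infinite_super[of "range f"] finite_imageD[OF _ \<open>inj f\<close>] by blast
qed

lemma nonzero_solution_of_curve_point:
  fixes u k :: rat
  assumes eq: "of_int t * u ^ 2 = 1 + 4 * k ^ 3" and "k \<noteq> 0"
  defines "s \<equiv> of_rat u * csqrt (of_int t)"
  shows "((1 + s) / 2, (1 - s) / 2, 1, - of_rat k) \<in> nonzero_solutions (quadratic_field t)"
proof -
  have field: "of_rat a + of_rat b * csqrt (of_int t) \<in> quadratic_field t" for a b
    unfolding quadratic_field_def by blast
  have "s ^ 2 = of_rat (of_int t * u ^ 2)"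
    by (simp add: s_def power_mult_distrib of_rat_mult of_rat_power)
  also have "\<dots> = 1 + 4 * of_rat k ^ 3"
    by (simp add: eq of_rat_add of_rat_mult of_rat_power)
  finally have prod: "(1 + s) / 2 * ((1 - s) / 2) = (- of_rat k) ^ 3"
    by (simp add: field_simps power2_eq_square power3_eq_cube)
  \<comment> \<open>The nonzero product \<open>(- k) ^ 3\<close> excludes \<open>s = 1\<close> and
    \<open>s = -1\<close> at once.\<close>
  have "(1 + s) / 2 * ((1 - s) / 2) \<noteq> 0"
    unfolding prod using \<open>k \<noteq> 0\<close> by simp
  then have "(1 + s) / 2 \<noteq> 0" "(1 - s) / 2 \<noteq> 0"
    by (auto simp only: mult_eq_0_iff)
  \<comment> \<open>The rational coordinates are \<open>1 / 2\<close> and \<open>u / 2\<close>,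
    respectively \<open>1 / 2\<close> and \<open>- u / 2\<close>.\<close>
  moreover have "(1 + s) / 2 \<in> quadratic_field t" "(1 - s) / 2 \<in> quadratic_field t"
    using field[of "1 / 2" "u / 2"] field[of "1 / 2" "- u / 2"]
    by (simp_all add: s_def of_rat_divide of_rat_minus add_divide_distrib diff_divide_distrib)
  moreover have "1 \<in> quadratic_field t" "- of_rat k \<in> quadratic_field t"
    using field[of 1 0] field[of "- k" 0] by (simp_all add: of_rat_minus)
  moreover have "(1 + s) / 2 + (1 - s) / 2 = 1"
    by (simp add: field_simps)
  ultimately show ?thesis
    using prod \<open>k \<noteq> 0\<close> by (simp only: nonzero_solutions_def mem_Collect_eq prod.case) simp
qed

theorem theorem6:
  fixes t :: int
  assumes "t \<noteq> 0" and "t \<noteq> 1" and "squarefree t"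
    and "\<exists>u k :: rat. (u, k) \<noteq> (0, 0) \<and> of_int t * u ^ 2 = 1 + 4 * k ^ 3"
  shows "infinite (nonzero_solutions (quadratic_field t))"
proof -
  obtain u k :: rat where eq: "of_int t * u ^ 2 = 1 + 4 * k ^ 3"
    using assms(4) by blast
  \<comment> \<open>For \<open>k = 0\<close> the curve equation reads \<open>t * u ^ 2 = 1\<close>,
    which forces the excluded value \<open>t = 1\<close>.\<close>
  have "k \<noteq> 0"
    using squarefree_int_rat_square_eq_1[OF assms(3), of u] assms(2) eq by auto
  then show ?thesis
    by (rule infinite_nonzero_solutions[OF nonzero_solution_of_curve_point[OF eq]])
qed

end
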